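(* Let $n$ be a positive integer. If a formula $\varphi$ in the language $\mathcal{L}$ is true in $\langle\mathcal{RC}(\mathbb{R}^n),C\rangle$, where $C$ is the standard topological contact, then $\varphi$ is a theorem of the formal system $\mathfrak{F}$.
   Context: **The algebra $\langle\mathcal{RC}(\mathbb{R}^n),C\rangle$.** $\mathbb{R}^n$ carries its usual topology. A set $A\subseteq\mathbb{R}^n$ is regular closed if $A=\mathrm{Cl}(\mathrm{Int}(A))$. The regular closed sets form a Boolean algebra $\mathcal{RC}(\mathbb{R}^n)$ with complement $A^*=\mathrm{Cl}(\mathbb{R}^n\setminus A)$, join $\cup$, zero $\emptyset$ and unit $\mathbb{R}^n$. The topological contact is: $C(A,B)$ iff $A\cap B\ne\emptyset$. **The language $\mathcal{L}$.** A countable set of individual variables; equality $\equiv$; connectives $\neg,\vee$; a unary function symbol $-$ and a binary function symbol $+$; a binary predicate symbol $C$. Terms are built from variables by $-$ and $+$. Formulas (quantifier-free) are built from atomic formulas $a\equiv b$, $C(a,b)$ ($a,b$ terms) by $\neg,\vee$. Abbreviations: the usual $\wedge,\Rightarrow,\Leftrightarrow$; $a\cdot b$ is $-((-a)+(-b))$; $0$ is $a\cdot(-a)$ (for a term $a$); $1$ is $-0$; $a\not\equiv b$ is $\neg(a\equiv b)$. **The system $\mathfrak{F}$.** Only rule: modus ponens. Axiom schemes, for all terms $a,b,c$: (1) a complete set of schemes for classical propositional logic; (2) schemes for equality (reflexivity, symmetry, transitivity, congruence with respect to $-,+,C$) and for Boolean algebras (associativity, commutativity, absorption and distributivity of $+$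 and $\cdot$; $a+(-a)\equiv 1$, $a\cdot(-a)\equiv 0$; $0\not\equiv 1$); (3) $\neg C(0,a)$; $C(a,b+c)\Leftrightarrow(C(a,b)\vee C(a,c))$; $C(a,b)\Rightarrow C(b,a)$; $a\not\equiv 0\Rightarrow C(a,a)$; (4) $a\not\equiv 0\Rightarrow(a\not\equiv 1\Rightarrow C(a,-a))$. **Truth.** In a Boolean algebra equipped with a binary relation, $-$ and $+$ are interpreted as complement and join, the symbol $C$ as the relation, $\equiv$ as equality. A formula is true in the structure iff it is true under every valuation of the variables by elements of the carrier. *)

theory Defs
  imports "HOL-Analysis.Analysis"
begin

datatype trm =
    Var nat
  | Cmpl trm  (\<open>\<^bold>-_\<close> [81] 80)
  | Join trm trm  (infixl \<open>\<^bold>+\<close> 65)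

datatype fm =
    Eq trm trm  (infix \<open>\<^bold>=\<close> 50)
  | Con trm trm
  | Neg fm  (\<open>\<^bold>\<not>_\<close> [41] 40)
  | Disj fm fm  (infixr \<open>\<^bold>\<or>\<close> 30)

abbreviation Meet :: "trm \<Rightarrow> trm \<Rightarrow> trm"  (infixl \<open>\<^bold>\<cdot>\<close> 70) where
  "a \<^bold>\<cdot> b \<equiv> \<^bold>-(\<^bold>-a \<^bold>+ \<^bold>-b)"

text \<open>The language has no constant symbols: \<open>0\<close> abbreviates \<open>z \<cdot> (-z)\<close> for some chosen
  term \<open>z\<close>. The choice is kept as an explicit parameter, here and in the formal system below.\<close>

abbreviation Zero :: "trm \<Rightarrow> trm" where
  "Zero z \<equiv> z \<^bold>\<cdot> \<^bold>-z"

abbreviation One :: "trm \<Rightarrow> trm" where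
  "One z \<equiv> \<^bold>-(Zero z)"

abbreviation Conj :: "fm \<Rightarrow> fm \<Rightarrow> fm"  (infixr \<open>\<^bold>\<and>\<close> 35) where
  "p \<^bold>\<and> q \<equiv> \<^bold>\<not>(\<^bold>\<not>p \<^bold>\<or> \<^bold>\<not>q)"

abbreviation Imp :: "fm \<Rightarrow> fm \<Rightarrow> fm"  (infixr \<open>\<^bold>\<longrightarrow>\<close> 25) where
  "p \<^bold>\<longrightarrow> q \<equiv> \<^bold>\<not>p \<^bold>\<or> q"

abbreviation Iff :: "fm \<Rightarrow> fm \<Rightarrow> fm"  (infix \<open>\<^bold>\<longleftrightarrow>\<close> 25) where
  "p \<^bold>\<longleftrightarrow> q \<equiv> (p \<^bold>\<longrightarrow> q) \<^bold>\<and> (q \<^bold>\<longrightarrow> p)"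

abbreviation Neq :: "trm \<Rightarrow> trm \<Rightarrow> fm"  (infix \<open>\<^bold>\<noteq>\<close> 50) where
  "a \<^bold>\<noteq> b \<equiv> \<^bold>\<not>(a \<^bold>= b)"

text \<open>The propositional schemes are those of Hilbert and Ackermann, which are complete for
  classical logic over negation and disjunction with modus ponens as the only rule.\<close>

inductive ax :: "trm \<Rightarrow> fm \<Rightarrow> bool" for z :: trm where
  prop_idem: "ax z (p \<^bold>\<or> p \<^bold>\<longrightarrow> p)"
| prop_weak: "ax z (p \<^bold>\<longrightarrow> p \<^bold>\<or> q)"
| prop_comm: "ax z (p \<^bold>\<or> q \<^bold>\<longrightarrow> q \<^bold>\<or> p)"
| prop_mono: "ax z ((q \<^bold>\<longrightarrow> r) \<^bold>\<longrightarrow> (p \<^bold>\<or> q \<^bold>\<longrightarrow> p \<^bold>\<or> r))"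
| eq_refl: "ax z (a \<^bold>= a)"
| eq_sym: "ax z (a \<^bold>= b \<^bold>\<longrightarrow> b \<^bold>= a)"
| eq_trans: "ax z (a \<^bold>= b \<^bold>\<longrightarrow> b \<^bold>= c \<^bold>\<longrightarrow> a \<^bold>= c)"
| eq_cmpl: "ax z (a \<^bold>= b \<^bold>\<longrightarrow> \<^bold>-a \<^bold>= \<^bold>-b)"
| eq_join: "ax z (a \<^bold>= b \<^bold>\<longrightarrow> c \<^bold>= d \<^bold>\<longrightarrow> a \<^bold>+ c \<^bold>= b \<^bold>+ d)"
| eq_con: "ax z (a \<^bold>= b \<^bold>\<longrightarrow> c \<^bold>= d \<^bold>\<longrightarrow> Con a c \<^bold>\<longrightarrow> Con b d)"
| join_assoc: "ax z (a \<^bold>+ (b \<^bold>+ c) \<^bold>= (a \<^bold>+ b) \<^bold>+ c)"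
| meet_assoc: "ax z (a \<^bold>\<cdot> (b \<^bold>\<cdot> c) \<^bold>= (a \<^bold>\<cdot> b) \<^bold>\<cdot> c)"
| join_comm: "ax z (a \<^bold>+ b \<^bold>= b \<^bold>+ a)"
| meet_comm: "ax z (a \<^bold>\<cdot> b \<^bold>= b \<^bold>\<cdot> a)"
| join_absorb: "ax z (a \<^bold>+ (a \<^bold>\<cdot> b) \<^bold>= a)"
| meet_absorb: "ax z (a \<^bold>\<cdot> (a \<^bold>+ b) \<^bold>= a)"
| join_distrib: "ax z (a \<^bold>+ (b \<^bold>\<cdot> c) \<^bold>= (a \<^bold>+ b) \<^bold>\<cdot> (a \<^bold>+ c))"
| meet_distrib: "ax z (a \<^bold>\<cdot> (b \<^bold>+ c) \<^bold>= (a \<^bold>\<cdot> b) \<^bold>+ (a \<^bold>\<cdot> c))"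
| join_cmpl: "ax z (a \<^bold>+ \<^bold>-a \<^bold>= One z)"
| meet_cmpl: "ax z (a \<^bold>\<cdot> \<^bold>-a \<^bold>= Zero z)"
| nontrivial: "ax z (Zero z \<^bold>\<noteq> One z)"
| con_zero: "ax z (\<^bold>\<not>(Con (Zero z) a))"
| con_join: "ax z (Con a (b \<^bold>+ c) \<^bold>\<longleftrightarrow> (Con a b \<^bold>\<or> Con a c))"
| con_sym: "ax z (Con a b \<^bold>\<longrightarrow> Con b a)"
| con_refl: "ax z (a \<^bold>\<noteq> Zero z \<^bold>\<longrightarrow> Con a a)"
| con_connected: "ax z (a \<^bold>\<noteq> Zero z \<^bold>\<longrightarrow> a \<^bold>\<noteq> One z \<^bold>\<longrightarrow> Con a (\<^bold>-a))"

inductive provable :: "trm \<Rightarrow> fm \<Rightarrow> bool" for z :: trm where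
  axiom: "ax z p \<Longrightarrow> provable z p"
| mp: "provable z p \<Longrightarrow> provable z (p \<^bold>\<longrightarrow> q) \<Longrightarrow> provable z q"

record 'a contact_structure =
  elems :: "'a set"
  cmpl :: "'a \<Rightarrow> 'a"
  join :: "'a \<Rightarrow> 'a \<Rightarrow> 'a"
  contact :: "'a \<Rightarrow> 'a \<Rightarrow> bool"

primrec trm_val :: "'a contact_structure \<Rightarrow> (nat \<Rightarrow> 'a) \<Rightarrow> trm \<Rightarrow> 'a" where
  "trm_val B v (Var i) = v i"
| "trm_val B v (\<^bold>-a) = cmpl B (trm_val B v a)"
| "trm_val B v (a \<^bold>+ b) = join B (trm_val B v a) (trm_val B v b)"

primrec sat :: "'a contact_structure \<Rightarrow> (nat \<Rightarrow> 'a) \<Rightarrow> fm \<Rightarrow> bool" where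
  "sat B v (a \<^bold>= b) \<longleftrightarrow> trm_val B v a = trm_val B v b"
| "sat B v (Con a b) \<longleftrightarrow> contact B (trm_val B v a) (trm_val B v b)"
| "sat B v (\<^bold>\<not>p) \<longleftrightarrow> \<not> sat B v p"
| "sat B v (p \<^bold>\<or> q) \<longleftrightarrow> sat B v p \<or> sat B v q"

definition true_in :: "'a contact_structure \<Rightarrow> fm \<Rightarrow> bool" where
  "true_in B p \<longleftrightarrow> (\<forall>v. (\<forall>i. v i \<in> elems B) \<longrightarrow> sat B v p)"

definition regular_closed :: "'a::topological_space set \<Rightarrow> bool" where
  "regular_closed A \<longleftrightarrow> A = closure (interior A)"

definition RC :: "'a::topological_space set contact_structure" where
  "RC = \<lparr> elems = {A. regular_closed A},
          cmpl = (\<lambda>A. closure (- A)),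
          join = (\<union>),
          contact = (\<lambda>A B. A \<inter> B \<noteq> {}) \<rparr>"

end

theory Submission
  imports Defs
begin

text \<open>Suppose that \<open>\<phi>\<close> is not provable. Lindenbaum's lemma (\<open>lindenbaum\<close>) gives a maximal theory
  \<open>G\<close> omitting \<open>\<phi>\<close>, and the task is to find regular closed sets of Euclidean space that make true
  exactly the members of \<open>G\<close>, as far as formulas in the first \<open>m\<close> variables are concerned.

  Only finitely many variables matter, so \<open>G\<close> is described by a finite graph. Its vertices are the
  products of literals over these variables (the cells) that \<open>G\<close> declares nonzero, and two cells are
  adjacent if \<open>G\<close> declares them to be in contact. Every term in these variables is modulo \<open>G\<close> the join of the cells below
  it, and contact distributes over joins; hence the graph determines all equations and all contacts
  in \<open>G\<close> (\<open>eqv_iff_worlds\<close>, \<open>con_iff_worlds\<close>). Every set of cells is the value of a term, so the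
  axiom that \<open>a\<close> touches its complement unless \<open>a\<close> is \<open>0\<close> or \<open>1\<close> says exactly that the graph is
  connected (\<open>worlds_connected\<close>).

  A finite connected reflexive graph has a walk, indexed by the integers, that traverses all of its
  edges in both directions (\<open>walk_through_all_edges\<close>). Cut the space into the slabs between consecutive
  integer values of one coordinate and label the slab number \<open>i\<close> by the \<open>i\<close>-th vertex \<open>w i\<close> of the
  walk. A set \<open>T\<close> of vertices is represented by the union of the slabs with label in \<open>T\<close>. Slabs meet
  iff they are equal or neighbours, and the labels of neighbours are precisely the edges of the
  graph. So this representation turns Boolean operations on sets of vertices into those of regular
  closed sets, and adjacency into topological contact. Because a single coordinate suffices, the
  dimension of the space is immaterial.\<close>

section \<open>Derivations from assumptions\<close>

inductive derives :: "trm \<Rightarrow> fm set \<Rightarrow> fm \<Rightarrow> bool" for z :: trm and G :: "fm set" where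
  hyp: "p \<in> G \<Longrightarrow> derives z G p"
| axm: "ax z p \<Longrightarrow> derives z G p"
| mp: "derives z G p \<Longrightarrow> derives z G (p \<^bold>\<longrightarrow> q) \<Longrightarrow> derives z G q"

lemma provable_if_derives_empty: "derives z {} p \<Longrightarrow> provable z p"
  by (induction rule: derives.induct) (auto intro: provable.intros)

lemma derives_mono: "derives z G p \<Longrightarrow> G \<subseteq> H \<Longrightarrow> derives z H p"
  by (induction rule: derives.induct) (auto intro: derives.intros)

lemma derives_imp_trans:
  assumes "derives z G (p \<^bold>\<longrightarrow> q)" "derives z G (q \<^bold>\<longrightarrow> r)"
  shows "derives z G (p \<^bold>\<longrightarrow> r)"
  by (rule derives.mp[OF assms(1) derives.mp[OF assms(2) derives.axm[OF prop_mono]]])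

lemma derives_disj_mono: "derives z G (q \<^bold>\<longrightarrow> r) \<Longrightarrow> derives z G (p \<^bold>\<or> q \<^bold>\<longrightarrow> p \<^bold>\<or> r)"
  by (rule derives.mp[OF _ derives.axm[OF prop_mono]])

lemma derives_imp_refl: "derives z G (p \<^bold>\<longrightarrow> p)"
  by (rule derives_imp_trans[OF derives.axm[OF prop_weak] derives.axm[OF prop_idem]])

lemma derives_disj_right: "derives z G (q \<^bold>\<longrightarrow> p \<^bold>\<or> q)"
  by (rule derives_imp_trans[OF derives.axm[OF prop_weak] derives.axm[OF prop_comm]])

lemma derives_imp_const: "derives z G q \<Longrightarrow> derives z G (p \<^bold>\<longrightarrow> q)"
  by (rule derives.mp[OF _ derives_disj_right])

text \<open>With \<open>prop_mono\<close> alone only the right disjunct can be changed; commuting in between reaches both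
  disjuncts, and \<open>prop_idem\<close> then merges the two copies of \<open>r\<close>.\<close>

lemma derives_disj_elim:
  assumes "derives z G (p \<^bold>\<longrightarrow> r)" "derives z G (q \<^bold>\<longrightarrow> r)"
  shows "derives z G (p \<^bold>\<or> q \<^bold>\<longrightarrow> r)"
proof -
  have "derives z G (p \<^bold>\<or> q \<^bold>\<longrightarrow> p \<^bold>\<or> r)"
    by (rule derives_disj_mono[OF assms(2)])
  moreover have "derives z G (p \<^bold>\<or> r \<^bold>\<longrightarrow> r \<^bold>\<or> p)"
    by (rule derives.axm[OF prop_comm])
  moreover have "derives z G (r \<^bold>\<or> p \<^bold>\<longrightarrow> r \<^bold>\<or> r)"
    by (rule derives_disj_mono[OF assms(1)])
  moreover have "derives z G (r \<^bold>\<or> r \<^bold>\<longrightarrow> r)"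
    by (rule derives.axm[OF prop_idem])
  ultimately show ?thesis
    by (blast intro: derives_imp_trans)
qed

text \<open>Since \<open>p \<^bold>\<longrightarrow> q\<close> abbreviates a disjunction, exchanging the premises \<open>p\<close> and \<open>q\<close> is a case
  distinction on the outer disjunction. After the exchange, \<open>prop_mono\<close> applies under the premise
  \<open>p\<close>, and the premise \<open>p\<close> that has been duplicated is contracted.\<close>

lemma derives_S:
  "derives z G ((p \<^bold>\<longrightarrow> q \<^bold>\<longrightarrow> r) \<^bold>\<longrightarrow> (p \<^bold>\<longrightarrow> q) \<^bold>\<longrightarrow> (p \<^bold>\<longrightarrow> r))"
proof -
  have "derives z G (\<^bold>\<not>p \<^bold>\<longrightarrow> p \<^bold>\<longrightarrow> r)"
    by (rule derives.axm[OF prop_weak])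
  then have "derives z G (\<^bold>\<not>p \<^bold>\<longrightarrow> q \<^bold>\<longrightarrow> p \<^bold>\<longrightarrow> r)"
    by (rule derives_imp_trans[OF _ derives_disj_right])
  moreover have "derives z G (r \<^bold>\<longrightarrow> p \<^bold>\<longrightarrow> r)"
    by (rule derives_disj_right)
  then have "derives z G ((q \<^bold>\<longrightarrow> r) \<^bold>\<longrightarrow> q \<^bold>\<longrightarrow> p \<^bold>\<longrightarrow> r)"
    by (rule derives_disj_mono)
  ultimately have "derives z G ((p \<^bold>\<longrightarrow> q \<^bold>\<longrightarrow> r) \<^bold>\<longrightarrow> q \<^bold>\<longrightarrow> p \<^bold>\<longrightarrow> r)"
    by (rule derives_disj_elim)
  moreover have "derives z G ((q \<^bold>\<longrightarrow> p \<^bold>\<longrightarrow> r) \<^bold>\<longrightarrow> (p \<^bold>\<longrightarrow> q) \<^bold>\<longrightarrow> (p \<^bold>\<longrightarrow> p \<^bold>\<longrightarrow> r))"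
    by (rule derives.axm[OF prop_mono])
  moreover have "derives z G ((p \<^bold>\<longrightarrow> p \<^bold>\<longrightarrow> r) \<^bold>\<longrightarrow> p \<^bold>\<longrightarrow> r)"
    by (rule derives_disj_elim[OF derives.axm[OF prop_weak] derives_imp_refl])
  then have "derives z G (((p \<^bold>\<longrightarrow> q) \<^bold>\<longrightarrow> p \<^bold>\<longrightarrow> p \<^bold>\<longrightarrow> r) \<^bold>\<longrightarrow> (p \<^bold>\<longrightarrow> q) \<^bold>\<longrightarrow> p \<^bold>\<longrightarrow> r)"
    by (rule derives_disj_mono)
  ultimately show ?thesis
    by (blast intro: derives_imp_trans)
qed

lemma deduction_theorem:
  "derives z (insert p G) q \<Longrightarrow> derives z G (p \<^bold>\<longrightarrow> q)"
proof (induction rule: derives.induct)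
  case (hyp q)
  then show ?case
    by (auto intro: derives_imp_refl derives_imp_const derives.hyp)
next
  case (axm q)
  then show ?case
    by (intro derives_imp_const derives.axm)
next
  case (mp q r)
  then show ?case
    by (blast intro: derives.mp[OF _ derives.mp[OF _ derives_S]])
qed

text \<open>A derivation uses finitely many assumptions, so they all lie in one member of the chain.
  Induction on the derivation replaces the bookkeeping of these finite sets: of two members of a chain
  one contains the other.\<close>

lemma derives_Union_chain:
  assumes "derives z (\<Union>C) p" "subset.chain A C" "C \<noteq> {}"
  shows "\<exists>G\<in>C. derives z G p"
  using assms(1)
proof (induction rule: derives.induct)
  case (hyp p)
  then show ?case
    by (auto intro: derives.hyp)
next
  case (axm p)
  then show ?case
    using assms(3) by (auto intro: derives.axm)
next
  case (mp p q)
  then obtain G H where GH: "G \<in> C" "H \<in> C" "derives z G p" "derives z H (p \<^bold>\<longrightarrow> q)"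
    by blast
  then have "G \<subseteq> H \<or> H \<subseteq> G"
    using assms(2) by (auto simp: subset.chain_def)
  then show ?case
    using GH derives_mono derives.mp[of z _ p q] by blast
qed


section \<open>Maximal theories\<close>

text \<open>By the two equivalences, membership in a maximal theory behaves like truth, so that each axiom
  becomes an ordinary implication between statements of the form \<open>p \<in> G\<close>.\<close>

locale maximal_theory =
  fixes z :: trm and G :: "fm set"
  assumes axiom_mem: "ax z p \<Longrightarrow> p \<in> G"
    and neg_mem [simp]: "(\<^bold>\<not>p) \<in> G \<longleftrightarrow> p \<notin> G"
    and disj_mem [simp]: "(p \<^bold>\<or> q) \<in> G \<longleftrightarrow> p \<in> G \<or> q \<in> G"

text \<open>By Zorn's lemma there is a set \<open>G\<close> that is maximal among those from which \<open>\<phi>\<close> cannot be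
  derived. Here \<open>\<phi>\<close> serves as falsity: by maximality and the deduction theorem every formula outside
  \<open>G\<close> implies \<open>\<phi>\<close>.\<close>

lemma lindenbaum:
  assumes "\<not> provable z \<phi>"
  obtains G where "maximal_theory z G" "\<phi> \<notin> G"
proof -
  let ?A = "{G. \<not> derives z G \<phi>}"
  have "?A \<noteq> {}"
    using assms provable_if_derives_empty by blast
  moreover have "\<Union>C \<in> ?A" if "C \<noteq> {}" "subset.chain ?A C" for C
  proof -
    have "\<not> (\<exists>G\<in>C. derives z G \<phi>)"
      using that(2) by (auto simp: subset.chain_def)
    then show ?thesis
      using derives_Union_chain[OF _ that(2,1)] by blast
  qed
  ultimately obtain G where G: "\<not> derives z G \<phi>"
    and max: "\<And>H. \<not> derives z H \<phi> \<Longrightarrow> G \<subseteq> H \<Longrightarrow> H = G"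
    using subset_Zorn_nonempty[of ?A] by auto
  have refutes: "derives z G (p \<^bold>\<longrightarrow> \<phi>)" if "p \<notin> G" for p
    using that max[of "insert p G"] by (intro deduction_theorem) blast
  have closed: "p \<in> G" if "derives z G p" for p
    using that refutes[of p] G derives.mp[OF that, of \<phi>] by blast
  have "maximal_theory z G"
  proof
    fix p assume "ax z p"
    then show "p \<in> G"
      using closed derives.axm by blast
  next
    fix p
    show "(\<^bold>\<not>p) \<in> G \<longleftrightarrow> p \<notin> G"
    proof
      assume "(\<^bold>\<not>p) \<in> G"
      then have "derives z G (p \<^bold>\<longrightarrow> \<phi>)"
        by (rule derives.mp[OF derives.hyp derives.axm[OF prop_weak]])
      then show "p \<notin> G"
        using G derives.mp[OF derives.hyp] by blast
    next
      assume "p \<notin> G"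
      show "(\<^bold>\<not>p) \<in> G"
      proof (rule ccontr)
        assume "(\<^bold>\<not>p) \<notin> G"
        then have "derives z G (\<^bold>\<not>p \<^bold>\<or> p \<^bold>\<longrightarrow> \<phi>)"
          using refutes \<open>p \<notin> G\<close> by (intro derives_disj_elim)
        then show False
          using G derives.mp[OF derives_imp_refl] by blast
      qed
    qed
  next
    fix p q
    show "(p \<^bold>\<or> q) \<in> G \<longleftrightarrow> p \<in> G \<or> q \<in> G"
    proof
      assume "(p \<^bold>\<or> q) \<in> G"
      then show "p \<in> G \<or> q \<in> G"
        using G derives.mp[OF derives.hyp derives_disj_elim[OF refutes refutes]] by blast
    next
      assume "p \<in> G \<or> q \<in> G"
      then show "(p \<^bold>\<or> q) \<in> G"
        using closed[OF derives.mp[OF derives.hyp derives.axm[OF prop_weak]]]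
          closed[OF derives.mp[OF derives.hyp derives_disj_right]] by blast
    qed
  qed
  moreover have "\<phi> \<notin> G"
    using G derives.hyp by blast
  ultimately show thesis
    by (rule that)
qed


section \<open>Cells and the contact graph of a maximal theory\<close>

text \<open>A set \<open>s\<close> of variables is read as the truth assignment that makes exactly its elements true.\<close>

primrec holds :: "nat set \<Rightarrow> trm \<Rightarrow> bool" where
  "holds s (Var i) \<longleftrightarrow> i \<in> s"
| "holds s (\<^bold>-a) \<longleftrightarrow> \<not> holds s a"
| "holds s (a \<^bold>+ b) \<longleftrightarrow> holds s a \<or> holds s b"

primrec trm_bound :: "trm \<Rightarrow> nat" where
  "trm_bound (Var i) = Suc i"
| "trm_bound (\<^bold>-a) = trm_bound a"
| "trm_bound (a \<^bold>+ b) = max (trm_bound a) (trm_bound b)"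

primrec fm_bound :: "fm \<Rightarrow> nat" where
  "fm_bound (a \<^bold>= b) = max (trm_bound a) (trm_bound b)"
| "fm_bound (Con a b) = max (trm_bound a) (trm_bound b)"
| "fm_bound (\<^bold>\<not>p) = fm_bound p"
| "fm_bound (p \<^bold>\<or> q) = max (fm_bound p) (fm_bound q)"

text \<open>The product of the literals over the first \<open>k\<close> variables that the assignment \<open>s\<close> makes true. The
  empty product is \<open>1\<close>, which is an abbreviation that depends on the term \<open>z\<close>.\<close>

primrec cell :: "trm \<Rightarrow> nat set \<Rightarrow> nat \<Rightarrow> trm" where
  "cell z s 0 = One z"
| "cell z s (Suc k) = cell z s k \<^bold>\<cdot> (if k \<in> s then Var k else \<^bold>-Var k)"

lemma cell_cong: "s \<inter> {..<k} = t \<inter> {..<k} \<Longrightarrow> cell z s k = cell z t k"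
proof (induction k)
  case (Suc k)
  then have "s \<inter> {..<k} = t \<inter> {..<k}" "k \<in> s \<longleftrightarrow> k \<in> t"
    by (auto simp: lessThan_Suc)
  then show ?case
    using Suc.IH by simp
qed simp

lemma holds_cell: "holds t (cell z s k) \<longleftrightarrow> (\<forall>i<k. i \<in> t \<longleftrightarrow> i \<in> s)"
  by (induction k) (auto simp: less_Suc_eq)

lemma trm_bound_cell: "trm_bound (cell z s k) \<le> max k (trm_bound z)"
  by (induction k) auto

text \<open>Disjunctive normal form. The bound on \<open>z\<close> enters because cells contain the term \<open>One z\<close>.\<close>

lemma term_for_set_of_cells:
  assumes "finite F" "F \<subseteq> Pow {..<m}" "trm_bound z \<le> m"
  obtains a where "trm_bound a \<le> m" "\<And>s. s \<subseteq> {..<m} \<Longrightarrow> holds s a \<longleftrightarrow> s \<in> F"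
proof -
  have "\<exists>a. trm_bound a \<le> m \<and> (\<forall>s\<subseteq>{..<m}. holds s a \<longleftrightarrow> s \<in> F)"
    using assms(1,2)
  proof (induction F rule: finite_induct)
    case empty
    then show ?case
      using assms(3) by (auto intro!: exI[of _ "Zero z"])
  next
    case (insert r F)
    then obtain a where a: "trm_bound a \<le> m" "\<forall>s\<subseteq>{..<m}. holds s a \<longleftrightarrow> s \<in> F"
      by auto
    have "holds s (cell z r m) \<longleftrightarrow> s = r" if "s \<subseteq> {..<m}" for s
      using that insert.prems by (auto simp: holds_cell)
    moreover have "trm_bound (cell z r m) \<le> m"
      using trm_bound_cell[of z r m] assms(3) by simp
    ultimately show ?case
      using a by (intro exI[of _ "cell z r m \<^bold>+ a"]) auto
  qed
  then show thesis
    using that by blast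
qed

context maximal_theory
begin

definition eqv :: "trm \<Rightarrow> trm \<Rightarrow> bool"  (infix \<open>\<doteq>\<close> 50) where
  "a \<doteq> b \<longleftrightarrow> (a \<^bold>= b) \<in> G"

definition con :: "trm \<Rightarrow> trm \<Rightarrow> bool" where
  "con a b \<longleftrightarrow> Con a b \<in> G"

lemma eqv_refl [simp]: "a \<doteq> a"
  and eqv_sym: "a \<doteq> b \<Longrightarrow> b \<doteq> a"
  and eqv_trans [trans]: "a \<doteq> b \<Longrightarrow> b \<doteq> c \<Longrightarrow> a \<doteq> c"
  and eqv_cmpl: "a \<doteq> b \<Longrightarrow> \<^bold>-a \<doteq> \<^bold>-b"
  and eqv_join: "a \<doteq> b \<Longrightarrow> c \<doteq> d \<Longrightarrow> a \<^bold>+ c \<doteq> b \<^bold>+ d"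
  and con_eqv: "con a c \<Longrightarrow> a \<doteq> b \<Longrightarrow> c \<doteq> d \<Longrightarrow> con b d"
  using axiom_mem[OF eq_refl[of z a]] axiom_mem[OF eq_sym[of z a b]]
    axiom_mem[OF eq_trans[of z a b c]] axiom_mem[OF eq_cmpl[of z a b]]
    axiom_mem[OF eq_join[of z a b c d]] axiom_mem[OF eq_con[of z a b c d]]
  by (auto simp: eqv_def con_def)

lemma eqv_meet: "a \<doteq> b \<Longrightarrow> c \<doteq> d \<Longrightarrow> a \<^bold>\<cdot> c \<doteq> b \<^bold>\<cdot> d"
  by (intro eqv_cmpl eqv_join)

lemma eqv_join_comm: "a \<^bold>+ b \<doteq> b \<^bold>+ a"
  and eqv_meet_comm: "a \<^bold>\<cdot> b \<doteq> b \<^bold>\<cdot> a"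
  and eqv_meet_assoc: "a \<^bold>\<cdot> (b \<^bold>\<cdot> c) \<doteq> (a \<^bold>\<cdot> b) \<^bold>\<cdot> c"
  and eqv_join_absorb: "a \<^bold>+ (a \<^bold>\<cdot> b) \<doteq> a"
  and eqv_meet_absorb: "a \<^bold>\<cdot> (a \<^bold>+ b) \<doteq> a"
  and eqv_meet_distrib: "a \<^bold>\<cdot> (b \<^bold>+ c) \<doteq> (a \<^bold>\<cdot> b) \<^bold>+ (a \<^bold>\<cdot> c)"
  and eqv_join_cmpl: "a \<^bold>+ \<^bold>-a \<doteq> One z"
  and eqv_meet_cmpl: "a \<^bold>\<cdot> \<^bold>-a \<doteq> Zero z"
  and not_zero_eqv_one: "\<not> Zero z \<doteq> One z"
  using axiom_mem[OF nontrivial] unfolding eqv_def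
  by (auto intro!: axiom_mem ax.intros)

lemma not_con_zero: "\<not> con (Zero z) a"
  and con_join_iff: "con a (b \<^bold>+ c) \<longleftrightarrow> con a b \<or> con a c"
  and con_sym: "con a b \<Longrightarrow> con b a"
  and con_refl: "\<not> a \<doteq> Zero z \<Longrightarrow> con a a"
  and con_cmpl: "\<not> a \<doteq> Zero z \<Longrightarrow> \<not> a \<doteq> One z \<Longrightarrow> con a (\<^bold>-a)"
  using axiom_mem[OF con_zero[of z a]] axiom_mem[OF con_join[of z a b c]]
    axiom_mem[OF ax.con_sym[of z a b]] axiom_mem[OF ax.con_refl[of z a]]
    axiom_mem[OF con_connected[of z a]]
  by (auto simp: eqv_def con_def)

lemma eqv_meet_one: "a \<^bold>\<cdot> One z \<doteq> a"
  using eqv_meet[OF eqv_refl eqv_sym[OF eqv_join_cmpl]] eqv_meet_absorb eqv_trans by blast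

lemma eqv_join_zero: "a \<^bold>+ Zero z \<doteq> a"
  using eqv_join[OF eqv_refl eqv_sym[OF eqv_meet_cmpl]] eqv_join_absorb eqv_trans by blast

lemma eqv_zero_join: "Zero z \<^bold>+ a \<doteq> a"
  using eqv_join_comm eqv_join_zero eqv_trans by blast

lemma eqv_join_idem: "a \<^bold>+ a \<doteq> a"
  using eqv_join[OF eqv_refl eqv_sym[OF eqv_meet_absorb]] eqv_join_absorb eqv_trans by blast

lemma eqv_meet_idem: "a \<^bold>\<cdot> a \<doteq> a"
  using eqv_meet[OF eqv_refl eqv_sym[OF eqv_join_absorb]] eqv_meet_absorb eqv_trans by blast

lemma eqv_meet_zero: "a \<^bold>\<cdot> Zero z \<doteq> Zero z"
proof -
  have "a \<^bold>\<cdot> Zero z \<doteq> a \<^bold>\<cdot> (a \<^bold>\<cdot> \<^bold>-a)"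
    by (rule eqv_meet[OF eqv_refl eqv_sym[OF eqv_meet_cmpl]])
  also have "\<dots> \<doteq> (a \<^bold>\<cdot> a) \<^bold>\<cdot> \<^bold>-a"
    by (rule eqv_meet_assoc)
  also have "\<dots> \<doteq> a \<^bold>\<cdot> \<^bold>-a"
    by (rule eqv_meet[OF eqv_meet_idem eqv_refl])
  also have "\<dots> \<doteq> Zero z"
    by (rule eqv_meet_cmpl)
  finally show ?thesis .
qed

lemma eqv_zero_meet: "Zero z \<^bold>\<cdot> a \<doteq> Zero z"
  using eqv_meet_comm eqv_meet_zero eqv_trans by blast

text \<open>Repeating this cut along one variable after the other resolves a term into its cells.\<close>

lemma eqv_split: "a \<doteq> a \<^bold>\<cdot> b \<^bold>+ a \<^bold>\<cdot> \<^bold>-b"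
proof -
  have "a \<doteq> a \<^bold>\<cdot> One z"
    by (rule eqv_sym[OF eqv_meet_one])
  also have "\<dots> \<doteq> a \<^bold>\<cdot> (b \<^bold>+ \<^bold>-b)"
    by (rule eqv_meet[OF eqv_refl eqv_sym[OF eqv_join_cmpl]])
  also have "\<dots> \<doteq> a \<^bold>\<cdot> b \<^bold>+ a \<^bold>\<cdot> \<^bold>-b"
    by (rule eqv_meet_distrib)
  finally show ?thesis .
qed

lemma eqv_replace: "a \<doteq> c \<Longrightarrow> b \<doteq> d \<Longrightarrow> c \<doteq> d \<Longrightarrow> a \<doteq> b"
  by (rule eqv_trans[OF eqv_trans eqv_sym])

lemma con_imp_nonzero: "con a b \<Longrightarrow> \<not> a \<doteq> Zero z"
  using con_eqv[of a b "Zero z" b] not_con_zero by auto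

text \<open>The term \<open>c\<close> decides \<open>a\<close> if it lies below \<open>a\<close> or is disjoint from \<open>a\<close>. Decisions are inherited
  by complements, by joins and by smaller terms \<open>c\<close>; so a cell decides every term in its variables,
  namely according to the truth value of the term under the assignment.\<close>

abbreviation decided :: "trm \<Rightarrow> trm \<Rightarrow> bool \<Rightarrow> bool" where
  "decided c a t \<equiv> c \<^bold>\<cdot> a \<doteq> (if t then c else Zero z)"

lemma decided_cmpl:
  assumes "decided c a t"
  shows "decided c (\<^bold>-a) (\<not> t)"
proof (cases t)
  case True
  have "c \<^bold>\<cdot> \<^bold>-a \<doteq> (c \<^bold>\<cdot> a) \<^bold>\<cdot> \<^bold>-a"
    by (rule eqv_meet[OF eqv_sym eqv_refl]) (use True assms in simp)
  also have "\<dots> \<doteq> c \<^bold>\<cdot> (a \<^bold>\<cdot> \<^bold>-a)"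
    by (rule eqv_sym[OF eqv_meet_assoc])
  also have "\<dots> \<doteq> c \<^bold>\<cdot> Zero z"
    by (rule eqv_meet[OF eqv_refl eqv_meet_cmpl])
  also have "\<dots> \<doteq> Zero z"
    by (rule eqv_meet_zero)
  finally show ?thesis
    using True by simp
next
  case False
  have "c \<doteq> c \<^bold>\<cdot> a \<^bold>+ c \<^bold>\<cdot> \<^bold>-a"
    by (rule eqv_split)
  also have "\<dots> \<doteq> Zero z \<^bold>+ c \<^bold>\<cdot> \<^bold>-a"
    by (rule eqv_join[OF _ eqv_refl]) (use False assms in simp)
  also have "\<dots> \<doteq> c \<^bold>\<cdot> \<^bold>-a"
    by (rule eqv_zero_join)
  finally show ?thesis
    using False eqv_sym[of c "c \<^bold>\<cdot> \<^bold>-a"] by simp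
qed

lemma decided_join:
  assumes "decided c a t" "decided c b u"
  shows "decided c (a \<^bold>+ b) (t \<or> u)"
proof -
  have "c \<^bold>\<cdot> (a \<^bold>+ b) \<doteq> c \<^bold>\<cdot> a \<^bold>+ c \<^bold>\<cdot> b"
    by (rule eqv_meet_distrib)
  also have "\<dots> \<doteq> (if t then c else Zero z) \<^bold>+ (if u then c else Zero z)"
    by (rule eqv_join[OF assms])
  also have "\<dots> \<doteq> (if t \<or> u then c else Zero z)"
    by (simp add: eqv_join_idem eqv_join_zero eqv_zero_join)
  finally show ?thesis .
qed

lemma decided_meet_left:
  assumes "decided c a t"
  shows "decided (c \<^bold>\<cdot> b) a t"
proof -
  have "(c \<^bold>\<cdot> b) \<^bold>\<cdot> a \<doteq> c \<^bold>\<cdot> (b \<^bold>\<cdot> a)"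
    by (rule eqv_sym[OF eqv_meet_assoc])
  also have "\<dots> \<doteq> c \<^bold>\<cdot> (a \<^bold>\<cdot> b)"
    by (rule eqv_meet[OF eqv_refl eqv_meet_comm])
  also have "\<dots> \<doteq> (c \<^bold>\<cdot> a) \<^bold>\<cdot> b"
    by (rule eqv_meet_assoc)
  also have "\<dots> \<doteq> (if t then c else Zero z) \<^bold>\<cdot> b"
    by (rule eqv_meet[OF assms eqv_refl])
  also have "\<dots> \<doteq> (if t then c \<^bold>\<cdot> b else Zero z)"
    by (simp add: eqv_zero_meet)
  finally show ?thesis .
qed

lemma decided_meet_right: "decided b a t \<Longrightarrow> decided (c \<^bold>\<cdot> b) a t"
proof -
  assume "decided b a t"
  have "(c \<^bold>\<cdot> b) \<^bold>\<cdot> a \<doteq> c \<^bold>\<cdot> (b \<^bold>\<cdot> a)"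
    by (rule eqv_sym[OF eqv_meet_assoc])
  also have "\<dots> \<doteq> c \<^bold>\<cdot> (if t then b else Zero z)"
    by (rule eqv_meet[OF eqv_refl \<open>decided b a t\<close>])
  also have "\<dots> \<doteq> (if t then c \<^bold>\<cdot> b else Zero z)"
    by (simp add: eqv_meet_zero)
  finally show ?thesis .
qed

lemma decided_var: "i < k \<Longrightarrow> decided (cell z s k) (Var i) (i \<in> s)"
proof (induction k)
  case (Suc k)
  show ?case
  proof (cases "i = k")
    case True
    have "decided (if k \<in> s then Var k else \<^bold>-Var k) (Var k) (k \<in> s)"
      using eqv_meet_idem eqv_trans[OF eqv_meet_comm eqv_meet_cmpl] by simp
    then show ?thesis
      unfolding True cell.simps by (rule decided_meet_right)
  next
    case False
    then show ?thesis
      using Suc unfolding cell.simps by (intro decided_meet_left) auto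
  qed
qed simp

lemma decided_cell: "trm_bound a \<le> m \<Longrightarrow> decided (cell z s m) a (holds s a)"
proof (induction a)
  case (Var i)
  then show ?case
    using decided_var[of i m s] by simp
next
  case (Cmpl a)
  then show ?case
    using decided_cmpl[of "cell z s m" a "holds s a"] by simp
next
  case (Join a b)
  then show ?case
    using decided_join[of "cell z s m" a "holds s a" b "holds s b"] by simp
qed

text \<open>A property of terms that is prime with respect to joins and holds of \<open>1\<close> must hold of some
  cell: cut \<open>1\<close> along the variables one after the other and keep a part that has the property.\<close>

lemma cell_witness:
  assumes cong: "\<And>c d. P c \<Longrightarrow> c \<doteq> d \<Longrightarrow> P d"
    and join: "\<And>c d. P (c \<^bold>+ d) \<Longrightarrow> P c \<or> P d"
    and one: "P (One z)"
  obtains s where "s \<subseteq> {..<m}" "P (cell z s m)"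
proof -
  have "\<exists>s\<subseteq>{..<k}. P (cell z s k)" for k
  proof (induction k)
    case 0
    then show ?case
      using one by auto
  next
    case (Suc k)
    then obtain s where s: "s \<subseteq> {..<k}" "P (cell z s k)"
      by blast
    have "P (cell z s k \<^bold>\<cdot> Var k) \<or> P (cell z s k \<^bold>\<cdot> \<^bold>-Var k)"
      using cong[OF s(2) eqv_split[of _ "Var k"]] join by blast
    moreover have "cell z (insert k s) k = cell z s k"
      by (rule cell_cong) auto
    moreover have "k \<notin> s"
      using s(1) by auto
    ultimately have "P (cell z (insert k s) (Suc k)) \<or> P (cell z s (Suc k))"
      by simp
    moreover have "insert k s \<subseteq> {..<Suc k}" "s \<subseteq> {..<Suc k}"
      using s(1) by auto
    ultimately show ?case
      by blast
  qed
  then show thesis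
    using that by blast
qed

text \<open>The cells that \<open>G\<close> declares nonzero are the atoms of the finite contact algebra described by
  \<open>G\<close>. Requiring \<open>s \<subseteq> {..<m}\<close> makes \<open>s\<close> unique for its cell.\<close>

definition worlds :: "nat \<Rightarrow> nat set set" where
  "worlds m = {s. s \<subseteq> {..<m} \<and> \<not> cell z s m \<doteq> Zero z}"

definition adj :: "nat \<Rightarrow> nat set \<Rightarrow> nat set \<Rightarrow> bool" where
  "adj m s t \<longleftrightarrow> con (cell z s m) (cell z t m)"

lemma finite_worlds: "finite (worlds m)"
  by (rule finite_subset[of _ "Pow {..<m}"]) (auto simp: worlds_def)

lemma adj_refl: "s \<in> worlds m \<Longrightarrow> adj m s s"
  by (simp add: adj_def worlds_def con_refl)

lemma adj_sym: "adj m s t \<Longrightarrow> adj m t s"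
  unfolding adj_def by (rule con_sym)

text \<open>For the converse direction, \<open>cell_witness\<close> yields a cell on which two inequivalent terms
  differ. This cell is nonzero, and it decides both terms.\<close>

lemma eqv_iff_worlds:
  assumes "trm_bound a \<le> m" "trm_bound b \<le> m"
  shows "a \<doteq> b \<longleftrightarrow> (\<forall>s\<in>worlds m. holds s a \<longleftrightarrow> holds s b)"
proof
  assume "a \<doteq> b"
  show "\<forall>s\<in>worlds m. holds s a \<longleftrightarrow> holds s b"
  proof
    fix s assume s: "s \<in> worlds m"
    let ?c = "cell z s m"
    have "(if holds s a then ?c else Zero z) \<doteq> ?c \<^bold>\<cdot> a"
      using decided_cell[OF assms(1)] eqv_sym by blast
    also have "\<dots> \<doteq> ?c \<^bold>\<cdot> b"
      using \<open>a \<doteq> b\<close> by (rule eqv_meet[OF eqv_refl])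
    also have "\<dots> \<doteq> (if holds s b then ?c else Zero z)"
      by (rule decided_cell[OF assms(2)])
    finally have "(if holds s a then ?c else Zero z) \<doteq> (if holds s b then ?c else Zero z)" .
    from this eqv_sym[OF this] show "holds s a \<longleftrightarrow> holds s b"
      using s by (auto simp: worlds_def split: if_splits)
  qed
next
  assume agree: "\<forall>s\<in>worlds m. holds s a \<longleftrightarrow> holds s b"
  show "a \<doteq> b"
  proof (rule ccontr)
    assume "\<not> a \<doteq> b"
    obtain s where s: "s \<subseteq> {..<m}" "\<not> a \<^bold>\<cdot> cell z s m \<doteq> b \<^bold>\<cdot> cell z s m"
    proof (rule cell_witness[where P = "\<lambda>c. \<not> a \<^bold>\<cdot> c \<doteq> b \<^bold>\<cdot> c"])
      show "\<not> a \<^bold>\<cdot> d \<doteq> b \<^bold>\<cdot> d" if "\<not> a \<^bold>\<cdot> c \<doteq> b \<^bold>\<cdot> c" "c \<doteq> d" for c d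
        using that(1) eqv_replace[OF eqv_meet[OF eqv_refl that(2)] eqv_meet[OF eqv_refl that(2)]]
        by blast
      show "\<not> a \<^bold>\<cdot> c \<doteq> b \<^bold>\<cdot> c \<or> \<not> a \<^bold>\<cdot> d \<doteq> b \<^bold>\<cdot> d"
        if "\<not> a \<^bold>\<cdot> (c \<^bold>+ d) \<doteq> b \<^bold>\<cdot> (c \<^bold>+ d)" for c d
        using that eqv_replace[OF eqv_meet_distrib eqv_meet_distrib eqv_join] by blast
      show "\<not> a \<^bold>\<cdot> One z \<doteq> b \<^bold>\<cdot> One z"
        using \<open>\<not> a \<doteq> b\<close> eqv_replace[OF eqv_sym[OF eqv_meet_one] eqv_sym[OF eqv_meet_one]]
        by blast
    qed
    let ?c = "cell z s m"
    have a: "a \<^bold>\<cdot> ?c \<doteq> (if holds s a then ?c else Zero z)"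
      using eqv_trans[OF eqv_meet_comm decided_cell[OF assms(1)]] .
    have b: "b \<^bold>\<cdot> ?c \<doteq> (if holds s b then ?c else Zero z)"
      using eqv_trans[OF eqv_meet_comm decided_cell[OF assms(2)]] .
    have "holds s a \<noteq> holds s b"
      using s(2) eqv_replace[OF a b] by (cases "holds s a"; cases "holds s b") simp_all
    moreover have "\<not> ?c \<doteq> Zero z"
    proof
      assume "?c \<doteq> Zero z"
      then have zero: "x \<^bold>\<cdot> ?c \<doteq> Zero z" for x
        by (rule eqv_trans[OF eqv_meet[OF eqv_refl] eqv_meet_zero])
      show False
        using s(2) eqv_replace[OF zero zero eqv_refl] by blast
    qed
    ultimately show False
      using agree s(1) by (auto simp: worlds_def)
  qed
qed

text \<open>Contact is prime with respect to joins, so \<open>a\<close> touches \<open>b\<close> already within one cell. The trace of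
  \<open>a\<close> on this cell is the whole cell or zero, and zero touches nothing.\<close>

lemma con_cell_witness:
  assumes "con a b" "trm_bound a \<le> m"
  obtains s where "s \<in> worlds m" "holds s a" "con (cell z s m) b"
proof -
  obtain s where s: "s \<subseteq> {..<m}" "con b (a \<^bold>\<cdot> cell z s m)"
  proof (rule cell_witness[where P = "\<lambda>c. con b (a \<^bold>\<cdot> c)"])
    show "con b (a \<^bold>\<cdot> d)" if "con b (a \<^bold>\<cdot> c)" "c \<doteq> d" for c d
      by (rule con_eqv[OF that(1) eqv_refl eqv_meet[OF eqv_refl that(2)]])
    show "con b (a \<^bold>\<cdot> c) \<or> con b (a \<^bold>\<cdot> d)" if "con b (a \<^bold>\<cdot> (c \<^bold>+ d))" for c d
      using con_eqv[OF that eqv_refl eqv_meet_distrib] by (simp only: con_join_iff)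
    show "con b (a \<^bold>\<cdot> One z)"
      using con_eqv[OF con_sym[OF assms(1)] eqv_refl eqv_sym[OF eqv_meet_one]] .
  qed
  let ?c = "cell z s m"
  have "a \<^bold>\<cdot> ?c \<doteq> (if holds s a then ?c else Zero z)"
    using eqv_trans[OF eqv_meet_comm decided_cell[OF assms(2)]] .
  then have "con (if holds s a then ?c else Zero z) b"
    by (rule con_eqv[OF con_sym[OF s(2)] _ eqv_refl])
  then have "holds s a" "con ?c b"
    using not_con_zero by (cases "holds s a"; simp)+
  then show thesis
    using that s(1) con_imp_nonzero[OF \<open>con ?c b\<close>] by (auto simp: worlds_def)
qed

lemma con_mono:
  assumes "con a b" "a \<^bold>\<cdot> c \<doteq> a"
  shows "con c b"
proof -
  have "c \<doteq> c \<^bold>+ c \<^bold>\<cdot> a"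
    by (rule eqv_sym[OF eqv_join_absorb])
  also have "\<dots> \<doteq> c \<^bold>+ a"
    by (rule eqv_join[OF eqv_refl eqv_trans[OF eqv_meet_comm assms(2)]])
  finally have "c \<^bold>+ a \<doteq> c"
    by (rule eqv_sym)
  moreover have "con b (c \<^bold>+ a)"
    using con_sym[OF assms(1)] by (subst con_join_iff) (rule disjI2)
  ultimately have "con b c"
    by (rule con_eqv[OF _ eqv_refl, rotated])
  then show ?thesis
    by (rule con_sym)
qed

lemma con_iff_worlds:
  assumes "trm_bound a \<le> m" "trm_bound b \<le> m"
  shows "con a b \<longleftrightarrow> (\<exists>s\<in>worlds m. \<exists>t\<in>worlds m. adj m s t \<and> holds s a \<and> holds t b)"
proof
  assume "con a b"
  then obtain s where s: "s \<in> worlds m" "holds s a" "con (cell z s m) b"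
    using con_cell_witness[OF _ assms(1)] by blast
  obtain t where "t \<in> worlds m" "holds t b" "con (cell z t m) (cell z s m)"
    using con_cell_witness[OF con_sym[OF s(3)] assms(2)] by blast
  then show "\<exists>s\<in>worlds m. \<exists>t\<in>worlds m. adj m s t \<and> holds s a \<and> holds t b"
    using s adj_sym unfolding adj_def by blast
next
  assume "\<exists>s\<in>worlds m. \<exists>t\<in>worlds m. adj m s t \<and> holds s a \<and> holds t b"
  then obtain s t where st: "con (cell z s m) (cell z t m)" "holds s a" "holds t b"
    by (auto simp: adj_def)
  have le: "cell z s m \<^bold>\<cdot> a \<doteq> cell z s m" "cell z t m \<^bold>\<cdot> b \<doteq> cell z t m"
    using decided_cell[OF assms(1), of s] decided_cell[OF assms(2), of t] st by simp_all
  show "con a b"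
    by (rule con_sym[OF con_mono[OF con_sym[OF con_mono[OF st(1) le(1)]] le(2)]])
qed

lemma worlds_nonempty:
  assumes "trm_bound z \<le> m"
  shows "worlds m \<noteq> {}"
  using not_zero_eqv_one eqv_iff_worlds[of "Zero z" m "One z"] assms by auto

text \<open>A nonempty proper set \<open>T\<close> without outgoing edges would be the set of cells below some term that is
  neither \<open>0\<close> nor \<open>1\<close> and does not touch its complement, against the axiom of connectedness.\<close>

lemma worlds_connected:
  assumes "trm_bound z \<le> m" "T \<subseteq> worlds m" "T \<noteq> {}" "T \<noteq> worlds m"
  shows "\<exists>s\<in>T. \<exists>t\<in>worlds m - T. adj m s t"
proof -
  have "finite T" "T \<subseteq> Pow {..<m}"
    using assms(2) finite_subset[OF _ finite_worlds] by (auto simp: worlds_def)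
  then obtain a where a: "trm_bound a \<le> m" "\<And>s. s \<subseteq> {..<m} \<Longrightarrow> holds s a \<longleftrightarrow> s \<in> T"
    using term_for_set_of_cells[OF _ _ assms(1)] by blast
  have holds_a: "holds s a \<longleftrightarrow> s \<in> T" if "s \<in> worlds m" for s
    using that a(2) by (auto simp: worlds_def)
  have "\<not> a \<doteq> Zero z"
    using eqv_iff_worlds[of a m "Zero z"] assms a(1) holds_a by auto
  moreover have "\<not> a \<doteq> One z"
    using eqv_iff_worlds[of a m "One z"] assms a(1) holds_a by auto
  ultimately have "con a (\<^bold>-a)"
    by (rule con_cmpl)
  then show ?thesis
    using con_iff_worlds[of a m "\<^bold>-a"] a(1) holds_a by auto
qed

end


section \<open>Walks through connected graphs\<close>

lemma successively_path:
  assumes "(u, s) \<in> {(x, y). x \<in> V \<and> y \<in> V \<and> R x y}\<^sup>*"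
  shows "\<exists>p. set p \<subseteq> V \<and> successively R (u # p) \<and> last (u # p) = s"
  using assms
proof (induction rule: converse_rtrancl_induct)
  case base
  then show ?case
    by (intro exI[of _ "[]"]) simp
next
  case (step u v)
  then obtain p where "set p \<subseteq> V" "successively R (v # p)" "last (v # p) = s"
    by blast
  then show ?case
    using step.hyps(1) by (intro exI[of _ "v # p"]) auto
qed

text \<open>By connectedness, a finite walk can be prolonged to the start of any edge and then along it;
  doing so for all edges one by one gives a finite walk that contains them all. It is made bi-infinite by
  standing still at both ends, where reflexivity is used.\<close>

lemma walk_through_all_edges:
  assumes "finite V" "V \<noteq> {}"
    and refl: "\<And>s. s \<in> V \<Longrightarrow> R s s"
    and conn: "\<And>T. T \<subseteq> V \<Longrightarrow> T \<noteq> {} \<Longrightarrow> T \<noteq> V \<Longrightarrow> \<exists>s\<in>T. \<exists>t\<in>V - T. R s t"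
  obtains w :: "int \<Rightarrow> 'a" where "\<And>i. w i \<in> V" "\<And>i. R (w i) (w (i + 1))"
    "\<And>s t. s \<in> V \<Longrightarrow> t \<in> V \<Longrightarrow> R s t \<Longrightarrow> \<exists>i. w i = s \<and> w (i + 1) = t"
proof -
  let ?E = "{(x, y). x \<in> V \<and> y \<in> V \<and> R x y}"
  have reach: "(u, s) \<in> ?E\<^sup>*" if "u \<in> V" "s \<in> V" for u s
  proof -
    (* The set of vertices reachable from u has no outgoing edge, so it is everything. *)
    let ?T = "{s \<in> V. (u, s) \<in> ?E\<^sup>*}"
    have "\<not> (\<exists>s\<in>?T. \<exists>t\<in>V - ?T. R s t)"
      by (auto dest: rtrancl_into_rtrancl[where r = ?E])
    then have "?T = V"
      using conn[of ?T] \<open>u \<in> V\<close> by blast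
    then show ?thesis
      using \<open>s \<in> V\<close> by blast
  qed
  have "finite ?E"
    by (rule finite_subset[of _ "V \<times> V"]) (use assms(1) in auto)
  have "\<exists>xs. xs \<noteq> [] \<and> set xs \<subseteq> V \<and> successively R xs \<and>
      (\<forall>(s, t)\<in>F. \<exists>ys zs. xs = ys @ [s, t] @ zs)" if "F \<subseteq> ?E" for F
    using finite_subset[OF that \<open>finite ?E\<close>] that
  proof (induction F rule: finite_induct)
    case empty
    obtain u where "u \<in> V"
      using assms(2) by blast
    then show ?case
      by (intro exI[of _ "[u]"]) simp
  next
    case (insert e F)
    then obtain xs where xs: "xs \<noteq> []" "set xs \<subseteq> V" "successively R xs"
      "\<forall>(s, t)\<in>F. \<exists>ys zs. xs = ys @ [s, t] @ zs"
      by auto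
    obtain s t where e: "e = (s, t)" "s \<in> V" "t \<in> V" "R s t"
      using insert.prems by auto
    have "last xs \<in> V"
      using xs(1,2) by auto
    then obtain p where p: "set p \<subseteq> V" "successively R (last xs # p)" "last (last xs # p) = s"
      using successively_path[OF reach[OF _ e(2)]] by blast
    have last: "last (xs @ p) = s"
      using p(3) xs(1) by (auto split: if_splits)
    have "successively R (xs @ p)"
      using xs(1,3) p(2) by (cases p) (auto simp: successively_append_iff)
    then have "successively R ((xs @ p) @ [t])"
      using last e(4) xs(1) by (subst successively_append_iff) auto
    moreover have "\<exists>ys zs. (xs @ p) @ [t] = ys @ [s, t] @ zs"
    proof -
      have "xs @ p = butlast (xs @ p) @ [s]"
        using last xs(1) by (metis append_butlast_last_id append_is_Nil_conv)
      then show ?thesis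
        by (metis append.assoc append_Cons append_Nil)
    qed
    moreover have "\<exists>ys zs. (xs @ p) @ [t] = ys @ [s', t'] @ zs" if old: "(s', t') \<in> F" for s' t'
    proof -
      obtain ys zs where "xs = ys @ [s', t'] @ zs"
        using bspec[OF xs(4) old] by auto
      then show ?thesis
        by (intro exI[of _ ys] exI[of _ "zs @ p @ [t]"]) simp
    qed
    ultimately show ?case
      using xs(2) p(1) e(1,3) by (intro exI[of _ "(xs @ p) @ [t]"] conjI ballI) (simp, simp, blast+)
  qed
  from this[OF subset_refl] obtain xs where xs: "xs \<noteq> []" "set xs \<subseteq> V" "successively R xs"
    and edges: "\<forall>(s, t)\<in>?E. \<exists>ys zs. xs = ys @ [s, t] @ zs"
    by (elim exE conjE)
  (* Negative indices are sent to the first vertex, since nat truncates at 0. *)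
  define w where "w i = xs ! min (nat i) (length xs - 1)" for i
  have w_mem: "w i \<in> V" for i
  proof -
    have "min (nat i) (length xs - 1) < length xs"
      using xs(1) by (cases xs) auto
    then show ?thesis
      using xs(2) by (auto simp: w_def)
  qed
  show thesis
  proof (rule that)
    show "w i \<in> V" for i
      by (rule w_mem)
    show "R (w i) (w (i + 1))" for i
    proof (cases "i \<ge> 0 \<and> Suc (nat i) < length xs")
      case True
      then have "w i = xs ! nat i" "w (i + 1) = xs ! Suc (nat i)"
        by (auto simp: w_def nat_add_distrib min_def)
      then show ?thesis
        using True xs(3) by (simp add: successively_conv_nth)
    next
      case False
      then have "min (nat (i + 1)) (length xs - 1) = min (nat i) (length xs - 1)"
        by linarith
      then have "w (i + 1) = w i"
        by (simp add: w_def)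
      then show ?thesis
        using refl w_mem by simp
    qed
    show "\<exists>i. w i = s \<and> w (i + 1) = t" if edge: "s \<in> V" "t \<in> V" "R s t" for s t
    proof -
      obtain ys zs where "xs = ys @ [s, t] @ zs"
        using bspec[OF edges, of "(s, t)"] edge by auto
      then have "w (int (length ys)) = s \<and> w (int (length ys) + 1) = t"
        by (simp add: w_def nat_add_distrib nth_append)
      then show ?thesis ..
    qed
  qed
qed


section \<open>Slabs of Euclidean space\<close>

text \<open>The union of the closed slabs \<open>i \<le> x $ k \<le> i + 1\<close> with \<open>w i \<in> T\<close>. The numbers of the slabs that
  contain \<open>x\<close> are \<open>\<lfloor>x $ k\<rfloor>\<close> and \<open>\<lceil>x $ k\<rceil> - 1\<close>, which coincide unless the coordinate is an integer.\<close>

definition slabs :: "'n::finite \<Rightarrow> (int \<Rightarrow> 'a) \<Rightarrow> 'a set \<Rightarrow> (real ^ 'n) set" where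
  "slabs k w T = {x. w \<lfloor>x $ k\<rfloor> \<in> T \<or> w (\<lceil>x $ k\<rceil> - 1) \<in> T}"

lemma slabs_Un: "slabs k w S \<union> slabs k w T = slabs k w (S \<union> T)"
  by (auto simp: slabs_def)

text \<open>Near any point only the slabs that contain the point itself occur, so the complement is open.\<close>

lemma closed_slabs: "closed (slabs k w T)"
proof -
  have "open {r::real. w \<lfloor>r\<rfloor> \<notin> T \<and> w (\<lceil>r\<rceil> - 1) \<notin> T}" (is "open ?U")
  proof (subst open_subopen, rule ballI)
    fix r assume r: "r \<in> ?U"
    let ?I = "{real_of_int (\<lceil>r\<rceil> - 1) <..< real_of_int (\<lfloor>r\<rfloor> + 1)}"
    have "r \<in> ?I"
      using floor_correct[of r] ceiling_correct[of r] by simp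
    moreover have "?I \<subseteq> ?U"
    proof
      fix y assume "y \<in> ?I"
      then have "\<lceil>r\<rceil> - 1 < y" "y < \<lfloor>r\<rfloor> + 1"
        by simp_all
      then have "\<lfloor>y\<rfloor> = \<lfloor>r\<rfloor> \<or> \<lfloor>y\<rfloor> = \<lceil>r\<rceil> - 1" "\<lceil>y\<rceil> - 1 = \<lfloor>r\<rfloor> \<or> \<lceil>y\<rceil> - 1 = \<lceil>r\<rceil> - 1"
        by linarith+
      then show "y \<in> ?U"
        using r by auto
    qed
    ultimately show "\<exists>S. open S \<and> r \<in> S \<and> S \<subseteq> ?U"
      by (intro exI[of _ ?I]) (simp add: open_greaterThanLessThan)
  qed
  then have "open ((\<lambda>x. x $ k) -` ?U)"
    by (rule open_vimage_vec_nth)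
  moreover have "(\<lambda>x. x $ k) -` ?U = - slabs k w T"
    by (auto simp: slabs_def)
  ultimately show ?thesis
    by (simp add: closed_def)
qed

text \<open>A point of a slab can be moved along the \<open>k\<close>-th axis by an arbitrarily small amount into the
  interior of that slab, where no other slab interferes. So the regular complement of a union of slabs is
  the union of the remaining slabs.\<close>

lemma closure_compl_slabs:
  fixes k :: "'n::finite"
  shows "closure (- slabs k w T) = slabs k w (- T)"
proof
  show "closure (- slabs k w T) \<subseteq> slabs k w (- T)"
    by (rule closure_minimal[OF _ closed_slabs]) (auto simp: slabs_def)
  show "slabs k w (- T) \<subseteq> closure (- slabs k w T)"
  proof
    fix x assume x: "x \<in> slabs k w (- T)"
    show "x \<in> closure (- slabs k w T)"
      unfolding closure_approachable
    proof (intro allI impI)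
      fix e :: real assume "e > 0"
      have "\<exists>d. \<bar>d\<bar> < e \<and> w \<lfloor>x $ k + d\<rfloor> \<notin> T \<and> w (\<lceil>x $ k + d\<rceil> - 1) \<notin> T"
      proof (cases "w \<lfloor>x $ k\<rfloor> \<in> T")
        case False
        (* Move upwards, at most half of the way to the upper face of the slab. *)
        define d where "d = min (e / 2) ((\<lfloor>x $ k\<rfloor> + 1 - x $ k) / 2)"
        have "d > 0" "d < e" "x $ k + d < \<lfloor>x $ k\<rfloor> + 1"
          using \<open>e > 0\<close> floor_correct[of "x $ k"] ceiling_correct[of "x $ k"]
          by (simp_all add: d_def min_def field_simps)
        then have "\<lfloor>x $ k + d\<rfloor> = \<lfloor>x $ k\<rfloor>" "\<lceil>x $ k + d\<rceil> - 1 = \<lfloor>x $ k\<rfloor>"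
          by linarith+
        then show ?thesis
          using False \<open>d > 0\<close> \<open>d < e\<close> by (intro exI[of _ d]) simp
      next
        case True
        then have notin: "w (\<lceil>x $ k\<rceil> - 1) \<notin> T"
          using x by (auto simp: slabs_def)
        (* Move downwards, at most half of the way to the lower face of the slab. *)
        define d where "d = min (e / 2) ((x $ k - (\<lceil>x $ k\<rceil> - 1)) / 2)"
        have "d > 0" "d < e" "x $ k - d > \<lceil>x $ k\<rceil> - 1"
          using \<open>e > 0\<close> floor_correct[of "x $ k"] ceiling_correct[of "x $ k"]
          by (simp_all add: d_def min_def field_simps)
        then have "\<lfloor>x $ k + - d\<rfloor> = \<lceil>x $ k\<rceil> - 1" "\<lceil>x $ k + - d\<rceil> - 1 = \<lceil>x $ k\<rceil> - 1"
          by linarith+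
        then show ?thesis
          using notin \<open>d > 0\<close> \<open>d < e\<close> by (intro exI[of _ "- d"]) simp
      qed
      then obtain d where d: "\<bar>d\<bar> < e" "w \<lfloor>x $ k + d\<rfloor> \<notin> T" "w (\<lceil>x $ k + d\<rceil> - 1) \<notin> T"
        by blast
      have norm_d: "norm (axis k d :: real ^ 'n) = \<bar>d\<bar>"
        by (simp add: norm_eq_sqrt_inner inner_axis_axis)
      show "\<exists>y\<in>- slabs k w T. dist y x < e"
        using d
        by (intro bexI[of _ "x + axis k d"]) (simp_all add: slabs_def dist_norm norm_d axis_nth)
    qed
  qed
qed

lemma regular_closed_slabs: "regular_closed (slabs k w T)"
proof -
  have "interior (slabs k w T) = - slabs k w (- T)"
    by (simp add: interior_closure closure_compl_slabs)
  then show ?thesis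
    by (simp add: regular_closed_def closure_compl_slabs)
qed

lemma slabs_eq_iff:
  fixes k :: "'n::finite"
  shows "slabs k w S = slabs k w T \<longleftrightarrow> (\<forall>i. w i \<in> S \<longleftrightarrow> w i \<in> T)"
proof
  assume eq: "slabs k w S = slabs k w T"
  show "\<forall>i. w i \<in> S \<longleftrightarrow> w i \<in> T"
  proof
    fix i :: int
    (* The midpoint of slab i lies in no other slab. *)
    define x :: "real ^ 'n" where "x = axis k (real_of_int i + 1 / 2)"
    have "x $ k = real_of_int i + 1 / 2"
      by (simp add: x_def axis_def)
    then have "\<lfloor>x $ k\<rfloor> = i" "\<lceil>x $ k\<rceil> - 1 = i"
      by linarith+
    then have "x \<in> slabs k w U \<longleftrightarrow> w i \<in> U" for U
      by (simp add: slabs_def)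
    then show "w i \<in> S \<longleftrightarrow> w i \<in> T"
      using eq by blast
  qed
qed (auto simp: slabs_def)

lemma slabs_meet_iff:
  fixes k :: "'n::finite"
  shows "slabs k w S \<inter> slabs k w T \<noteq> {} \<longleftrightarrow> (\<exists>i j. \<bar>i - j\<bar> \<le> 1 \<and> w i \<in> S \<and> w j \<in> T)"
proof
  assume "slabs k w S \<inter> slabs k w T \<noteq> {}"
  then obtain x where "x \<in> slabs k w S" "x \<in> slabs k w T"
    by blast
  moreover have "\<bar>\<lfloor>x $ k\<rfloor> - (\<lceil>x $ k\<rceil> - 1)\<bar> \<le> 1" "\<bar>(\<lceil>x $ k\<rceil> - 1) - \<lfloor>x $ k\<rfloor>\<bar> \<le> 1"
    by linarith+
  ultimately show "\<exists>i j. \<bar>i - j\<bar> \<le> 1 \<and> w i \<in> S \<and> w j \<in> T"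
    unfolding slabs_def by (smt (verit) mem_Collect_eq)
next
  assume "\<exists>i j. \<bar>i - j\<bar> \<le> 1 \<and> w i \<in> S \<and> w j \<in> T"
  then obtain i j where ij: "\<bar>i - j\<bar> \<le> 1" "w i \<in> S" "w j \<in> T"
    by blast
  (* The common face of two neighbouring slabs is at the larger of their numbers; if the two
     slabs are equal, this point is on the lower face. *)
  define x :: "real ^ 'n" where "x = axis k (real_of_int (max i j))"
  have x: "x $ k = real_of_int (max i j)"
    by (simp add: x_def axis_def)
  have "max i j = i \<or> max i j - 1 = i" "max i j = j \<or> max i j - 1 = j"
    using ij(1) by linarith+
  then have "x \<in> slabs k w S" "x \<in> slabs k w T"
    using ij(2,3) unfolding slabs_def mem_Collect_eq x floor_of_int ceiling_of_int by metis+
  then show "slabs k w S \<inter> slabs k w T \<noteq> {}"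
    by blast
qed

text \<open>The variable \<open>i\<close> is interpreted by the slabs whose label makes it true. Then the same holds of
  every term, because \<open>slabs k w\<close> preserves joins and complements.\<close>

lemma trm_val_slabs:
  "trm_val RC (\<lambda>i. slabs k w {s. i \<in> s}) a = slabs k w {s. holds s a}"
proof (induction a)
  case (Cmpl a)
  then show ?case
    using closure_compl_slabs[of k w "{s. holds s a}"] by (simp add: RC_def Collect_neg_eq)
next
  case (Join a b)
  then show ?case
    by (simp add: RC_def slabs_Un Collect_disj_eq)
qed simp

lemma contact_RC: "contact RC A B \<longleftrightarrow> A \<inter> B \<noteq> {}"
  by (simp add: RC_def)


section \<open>Completeness\<close>

context maximal_theory
begin

text \<open>The truth lemma. Equality of values needs that the walk visits every world, contact of values
  that its steps are exactly the adjacent pairs of worlds.\<close>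

lemma sat_slabs_iff:
  assumes w: "\<And>i. w i \<in> worlds m" "\<And>i. adj m (w i) (w (i + 1))"
    and edges: "\<And>s t. s \<in> worlds m \<Longrightarrow> t \<in> worlds m \<Longrightarrow> adj m s t \<Longrightarrow> \<exists>i. w i = s \<and> w (i + 1) = t"
    and "fm_bound p \<le> m"
  shows "sat RC (\<lambda>i. slabs k w {s. i \<in> s}) p \<longleftrightarrow> p \<in> G"
  using assms(4)
proof (induction p)
  case (Eq a b)
  have "range w = worlds m"
    using w(1) edges adj_refl by blast
  then have "(\<forall>i. holds (w i) a \<longleftrightarrow> holds (w i) b) \<longleftrightarrow> (\<forall>s\<in>worlds m. holds s a \<longleftrightarrow> holds s b)"
    by (metis rangeE rangeI)
  then show ?case
    using Eq eqv_iff_worlds[of a m b] by (simp add: trm_val_slabs slabs_eq_iff eqv_def)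
next
  case (Con a b)
  have near: "adj m (w i) (w j)" if "\<bar>i - j\<bar> \<le> 1" for i j
  proof -
    have "j = i \<or> j = i + 1 \<or> i = j + 1"
      using that by linarith
    then show ?thesis
      using w adj_refl adj_sym by blast
  qed
  have "(\<exists>i j. \<bar>i - j\<bar> \<le> 1 \<and> holds (w i) a \<and> holds (w j) b) \<longleftrightarrow>
      (\<exists>s\<in>worlds m. \<exists>t\<in>worlds m. adj m s t \<and> holds s a \<and> holds t b)" (is "?L \<longleftrightarrow> ?R")
  proof
    show "?L \<Longrightarrow> ?R"
      using near w(1) by blast
    assume ?R
    then obtain i where "holds (w i) a" "holds (w (i + 1)) b"
      using edges by metis
    then show ?L
      by (intro exI[of _ i] exI[of _ "i + 1"]) simp
  qed
  then show ?case
    using Con con_iff_worlds[of a m b]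
    by (simp add: trm_val_slabs slabs_meet_iff con_def contact_RC)
qed auto

end

theorem theorem4p35:
  fixes z :: trm and \<phi> :: fm
  assumes "true_in (RC :: (real ^ 'n::finite) set contact_structure) \<phi>"
  shows "provable z \<phi>"
proof (rule ccontr)
  assume "\<not> provable z \<phi>"
  then obtain G where "maximal_theory z G" and \<phi>: "\<phi> \<notin> G"
    by (rule lindenbaum)
  then interpret maximal_theory z G
    by simp
  (* The first m variables must include those of z, so that the cells decide 0 and 1. *)
  define m where "m = max (fm_bound \<phi>) (trm_bound z)"
  have m: "fm_bound \<phi> \<le> m" "trm_bound z \<le> m"
    by (simp_all add: m_def)
  obtain w :: "int \<Rightarrow> nat set" where w: "\<And>i. w i \<in> worlds m" "\<And>i. adj m (w i) (w (i + 1))"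
    "\<And>s t. s \<in> worlds m \<Longrightarrow> t \<in> worlds m \<Longrightarrow> adj m s t \<Longrightarrow> \<exists>i. w i = s \<and> w (i + 1) = t"
    using walk_through_all_edges[of "worlds m" "adj m", OF finite_worlds
        worlds_nonempty[OF m(2)] adj_refl worlds_connected[OF m(2)]] by blast
  fix k :: 'n
  let ?v = "\<lambda>i. slabs k w {s. i \<in> s}"
  have "\<forall>i. ?v i \<in> elems RC"
    by (simp add: RC_def regular_closed_slabs)
  then have "sat RC ?v \<phi>"
    using assms[unfolded true_in_def, THEN spec, of ?v] by blast
  then show False
    using sat_slabs_iff[OF w m(1)] \<phi> by blast
qed

end
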